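(* Let $G=(V,E)$ be an undirected, unweighted graph with $n$ nodes, Laplacian $L$ and maximum degree $d_{\max}=\max_{i\in\{1,\dots,n\}}d_i$, let $D>0$, and let $\mu_1,\dots,\mu_n$ be the eigenvalues of $-L$. Let $$\lambda_i^{+}=\frac{-D+\sqrt{D^2+4\mu_i}}{2},\qquad \lambda_i^{-}=\frac{-D-\sqrt{D^2+4\mu_i}}{2},\qquad i=1,\dots,n,$$ be the eigenvalues of the matrix $$\mathcal A=\begin{bmatrix}-D\,\mathbb I & \mathbb I\\ -L & 0\end{bmatrix}.$$ Then the following hold: (1) all eigenvalues $\lambda_i^+,\lambda_i^-$, $i=1,\dots,n$, are real and negative if $D\ge\sqrt{8\,d_{\max}}$; (2) there exists at least one complex eigenvalue among the $\lambda_i^{\pm}$ if $D\le\sqrt{4\,d_{\max}}$.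
   Context: $d_i$ denotes the degree of node $i$. The graph Laplacian $L=[l_{ij}]$ has $l_{ij}=-1$ if $(i,j)$ is an edge and $i\ne j$, $l_{ii}=d_i$, and $l_{ij}=0$ otherwise. "Complex" means non-real. The matrix $\mathcal A$ is the state matrix of a network of $n$ homogeneous interconnected micro-grids with common damping constant $D$, unit inertia constants, and unit synchronizing coefficients on the edges, with state $(X_1,X_2)$ consisting of the vectors of frequency deviations and power flows.
   Formalization: In (1), "real and negative" fails for every graph since −L has eigenvalue 0, giving λ_i^+ = 0; what is proved is that all λ_i^± are real and negative, except that λ_i^+ = 0 exactly when μ_i = 0. *)

theory Defs
  imports
    Complex_Main
    "Jordan_Normal_Form.Char_Poly"
    "Graph_Theory.Pair_Digraph"
begin

text \<open>
  A finite simple undirected graph is a \<^locale>\<open>pair_graph\<close>: finite, loop-free, with a symmetric set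
  of arcs, so an edge between i and j is the pair of arcs (i, j) and (j, i), and the number of arcs
  leaving a node is its degree. The n nodes are numbered from 0 to n - 1.
\<close>

abbreviation node_degree :: "nat pair_pre_digraph \<Rightarrow> nat \<Rightarrow> nat" where
  "node_degree G i \<equiv> out_degree (with_proj G) i"

definition max_degree :: "nat pair_pre_digraph \<Rightarrow> nat" where
  "max_degree G = Max (node_degree G ` pverts G)"

definition laplacian :: "nat \<Rightarrow> nat pair_pre_digraph \<Rightarrow> real mat" where
  "laplacian n G = mat n n (\<lambda>(i, j).
     if i = j then real (node_degree G i)
     else if (i, j) \<in> parcs G then -1
     else 0)"

definition state_matrix :: "real \<Rightarrow> nat \<Rightarrow> nat pair_pre_digraph \<Rightarrow> real mat" where
  "state_matrix D n G =
     four_block_mat ((- D) \<cdot>\<^sub>m 1\<^sub>m n) (1\<^sub>m n)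
                    (- laplacian n G)  (0\<^sub>m n n)"

text \<open>
  Eigenvalues of a real matrix are taken over the complex numbers and listed with algebraic
  multiplicity.
\<close>

definition eigenvalue_list :: "real mat \<Rightarrow> complex list \<Rightarrow> bool" where
  "eigenvalue_list A es \<longleftrightarrow>
     char_poly (map_mat complex_of_real A) = (\<Prod>e\<leftarrow>es. [:- e, 1:])"

definition lambda_plus :: "real \<Rightarrow> complex \<Rightarrow> complex" where
  "lambda_plus D \<mu> = (- complex_of_real D + csqrt ((complex_of_real D)\<^sup>2 + 4 * \<mu>)) / 2"

definition lambda_minus :: "real \<Rightarrow> complex \<Rightarrow> complex" where
  "lambda_minus D \<mu> = (- complex_of_real D - csqrt ((complex_of_real D)\<^sup>2 + 4 * \<mu>)) / 2"

end

theory Submission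
  imports Defs "Jordan_Normal_Form.Spectral_Radius"
begin

text \<open>
  The blocks of the lower row of the characteristic matrix of \<open>A\<close> commute, so the
  characteristic polynomial of \<open>A\<close> is that of \<open>- L\<close> evaluated at \<open>x\<^sup>2 + D x\<close>, and each factor
  \<open>x\<^sup>2 + D x - \<mu>\<^sub>i\<close> splits into the linear factors of \<open>\<lambda>\<^sub>i\<^sup>+\<close> and \<open>\<lambda>\<^sub>i\<^sup>-\<close>. As \<open>L\<close> is symmetric and
  diagonally dominant, Gershgorin's theorem puts the \<open>\<mu>\<^sub>i\<close> into \<open>[- 2 d\<^sub>m\<^sub>a\<^sub>x, 0]\<close>, which gives (1).

  For (2) it suffices that some \<open>\<mu>\<^sub>i\<close> is strictly below \<open>- d\<^sub>m\<^sub>a\<^sub>x\<close>. The row of a node of maximum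
  degree has squared Euclidean norm \<open>r = d\<^sub>m\<^sub>a\<^sub>x\<^sup>2 + d\<^sub>m\<^sub>a\<^sub>x\<close>, and a real symmetric matrix has an
  eigenvalue of modulus at least the norm of any of its rows: the corresponding diagonal entry of
  the power of exponent \<open>2 ^ Suc k\<close> is at least \<open>r ^ 2 ^ k\<close>, while the powers of a matrix of
  spectral radius below 1 are bounded.
\<close>

section \<open>Characteristic polynomial of a block matrix of companion shape\<close>

lemma char_poly_companion_block:
  fixes K :: "'a :: field mat"
  assumes K: "K \<in> carrier_mat n n"
  shows "char_poly (four_block_mat (a \<cdot>\<^sub>m 1\<^sub>m n) (1\<^sub>m n) K (0\<^sub>m n n)) = char_poly K \<circ>\<^sub>p [:0, - a, 1:]"
proof -
  let ?q = "[:0, - a, 1:]"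
  let ?C = "map_mat (\<lambda>k. [:- k:]) K"
  \<comment> \<open>Substituting a fixed polynomial is a ring homomorphism, so it can be pulled out
    of the determinant of the characteristic matrix of \<open>K\<close>.\<close>
  have hom: "comm_ring_hom (\<lambda>p. p \<circ>\<^sub>p ?q)"
    by unfold_locales (auto simp: pcompose_add pcompose_mult)
  have "char_poly_matrix (four_block_mat (a \<cdot>\<^sub>m 1\<^sub>m n) (1\<^sub>m n) K (0\<^sub>m n n)) =
      four_block_mat ([:- a, 1:] \<cdot>\<^sub>m 1\<^sub>m n) (- 1\<^sub>m n) ?C ([:0, 1:] \<cdot>\<^sub>m 1\<^sub>m n)"
    using K by (intro eq_matI) (auto simp: char_poly_matrix_def one_pCons)
  \<comment> \<open>The lower right block is scalar and hence commutes with \<open>?C\<close>; this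
    is what reduces the determinant to one of size \<open>n\<close>.\<close>
  moreover have "det (four_block_mat ([:- a, 1:] \<cdot>\<^sub>m 1\<^sub>m n) (- 1\<^sub>m n) ?C ([:0, 1:] \<cdot>\<^sub>m 1\<^sub>m n)) =
      det (([:- a, 1:] \<cdot>\<^sub>m 1\<^sub>m n) * ([:0, 1:] \<cdot>\<^sub>m 1\<^sub>m n) - (- 1\<^sub>m n) * ?C)"
    using K by (intro det_four_block_mat) (auto simp: mult_smult_distrib)
  moreover have "([:- a, 1:] \<cdot>\<^sub>m 1\<^sub>m n) * ([:0, 1:] \<cdot>\<^sub>m 1\<^sub>m n) - (- 1\<^sub>m n) * ?C =
      map_mat (\<lambda>p. p \<circ>\<^sub>p ?q) (char_poly_matrix K)"
  proof -
    have "([:- a, 1:] \<cdot>\<^sub>m 1\<^sub>m n) * ([:0, 1:] \<cdot>\<^sub>m 1\<^sub>m n) = ?q \<cdot>\<^sub>m (1\<^sub>m n :: 'a poly mat)"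
      by (subst mult_smult_distrib[of _ n n]) auto
    moreover have "(- 1\<^sub>m n) * ?C = - ?C"
      using K by auto
    ultimately show ?thesis
      using K by (intro eq_matI) (auto simp: char_poly_matrix_def pcompose_pCons)
  qed
  ultimately show ?thesis
    by (simp add: char_poly_def comm_ring_hom.hom_det[OF hom])
qed

section \<open>Location of eigenvalues: real spectrum and Gershgorin discs\<close>

text \<open>At an eigenvector the Hermitian form of \<open>A\<close> is \<open>e\<close> times the
  squared norm, and it is its own conjugate because \<open>A\<close> is real and symmetric.\<close>

lemma eigenvalue_real_symmetric:
  fixes A :: "real mat"
  assumes A: "A \<in> carrier_mat n n"
    and sym: "transpose_mat A = A"
    and ev: "eigenvalue (map_mat complex_of_real A) e"
  shows "e \<in> \<real>"
proof -
  obtain v where v: "v \<in> carrier_vec n" "v \<noteq> 0\<^sub>v n"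
    and Av: "map_mat complex_of_real A *\<^sub>v v = e \<cdot>\<^sub>v v"
    using ev A unfolding eigenvalue_def eigenvector_def by auto
  have row: "(\<Sum>j<n. A $$ (i, j) * v $ j) = e * v $ i" if "i < n" for i
    using arg_cong[OF Av, of "\<lambda>w. w $ i"] that A v(1)
    by (simp add: scalar_prod_def atLeast0LessThan)
  have entry_sym: "A $$ (i, j) = A $$ (j, i)" if "i < n" "j < n" for i j
    using that A by (subst (1) sym[symmetric]) simp
  define s where "s = (\<Sum>i<n. (cmod (v $ i))\<^sup>2)"
  have "s \<noteq> 0"
  proof
    assume "s = 0"
    then have "\<forall>i<n. v $ i = 0"
      by (subst (asm) s_def, subst (asm) sum_nonneg_eq_0_iff) auto
    then show False using v by auto
  qed
  have quad: "(\<Sum>i<n. \<Sum>j<n. cnj (v $ i) * (A $$ (i, j) * v $ j)) = e * s"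
  proof -
    have "(\<Sum>j<n. cnj (v $ i) * (A $$ (i, j) * v $ j)) = e * of_real ((cmod (v $ i))\<^sup>2)"
      if "i < n" for i
      using that by (subst sum_distrib_left[symmetric], subst row)
        (simp_all add: complex_norm_square[symmetric] mult_ac)
    then show ?thesis by (simp add: s_def sum_distrib_left)
  qed
  have "cnj (e * s) = (\<Sum>i<n. \<Sum>j<n. v $ i * (A $$ (i, j) * cnj (v $ j)))"
    by (subst quad[symmetric]) simp
  also have "\<dots> = (\<Sum>j<n. \<Sum>i<n. v $ i * (A $$ (i, j) * cnj (v $ j)))"
    by (rule sum.swap)
  also have "\<dots> = (\<Sum>j<n. \<Sum>i<n. cnj (v $ j) * (A $$ (j, i) * v $ i))"
    by (intro sum.cong refl) (simp add: entry_sym mult_ac)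
  also have "\<dots> = e * s" by (rule quad)
  finally have "cnj e = e" using \<open>s \<noteq> 0\<close> by simp
  then show ?thesis by (simp add: Reals_cnj_iff)
qed

text \<open>The right row is the one where an eigenvector has its entry of largest modulus: that
  modulus bounds every other entry and then cancels.\<close>

lemma gershgorin:
  fixes A :: "complex mat"
  assumes A: "A \<in> carrier_mat n n" and ev: "eigenvalue A e"
  shows "\<exists>i<n. cmod (e - A $$ (i, i)) \<le> (\<Sum>j\<in>{..<n} - {i}. cmod (A $$ (i, j)))"
proof -
  obtain v where v: "v \<in> carrier_vec n" "v \<noteq> 0\<^sub>v n" and Av: "A *\<^sub>v v = e \<cdot>\<^sub>v v"
    using ev A unfolding eigenvalue_def eigenvector_def by auto
  have "n \<noteq> 0" using v by auto
  then have "Max ((\<lambda>j. cmod (v $ j)) ` {..<n}) \<in> (\<lambda>j. cmod (v $ j)) ` {..<n}"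
    by (intro Max_in) auto
  then obtain i where i: "i < n" and "cmod (v $ i) = Max ((\<lambda>j. cmod (v $ j)) ` {..<n})"
    by auto
  then have max: "cmod (v $ j) \<le> cmod (v $ i)" if "j < n" for j
    using that by simp
  have pos: "cmod (v $ i) > 0"
  proof (rule ccontr)
    assume "\<not> cmod (v $ i) > 0"
    then have "v $ j = 0" if "j < n" for j
      using max[OF that] by (metis norm_le_zero_iff not_less order_trans)
    then show False using v by auto
  qed
  have "e * v $ i = (\<Sum>j<n. A $$ (i, j) * v $ j)"
    using arg_cong[OF Av, of "\<lambda>w. w $ i"] i A v(1)
    by (simp add: scalar_prod_def atLeast0LessThan)
  also have "\<dots> = A $$ (i, i) * v $ i + (\<Sum>j\<in>{..<n} - {i}. A $$ (i, j) * v $ j)"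
    using i by (simp add: sum.remove)
  finally have "cmod (e - A $$ (i, i)) * cmod (v $ i) = cmod (\<Sum>j\<in>{..<n} - {i}. A $$ (i, j) * v $ j)"
    by (simp add: algebra_simps flip: norm_mult)
  also have "\<dots> \<le> (\<Sum>j\<in>{..<n} - {i}. cmod (A $$ (i, j)) * cmod (v $ i))"
    using max by (intro sum_norm_le) (auto simp: norm_mult intro: mult_left_mono)
  finally show ?thesis
    using pos i by (auto simp flip: sum_distrib_right)
qed

section \<open>Powers of a symmetric matrix and a lower bound for its spectral radius\<close>

lemma symmetric_pow_mat:
  fixes A :: "'a :: comm_semiring_1 mat"
  assumes A: "A \<in> carrier_mat n n" and sym: "transpose_mat A = A"
  shows "transpose_mat (A ^\<^sub>m k) = A ^\<^sub>m k"
proof (induction k)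
  case (Suc k)
  have "transpose_mat (A ^\<^sub>m Suc k) = A * A ^\<^sub>m k"
    using A sym Suc by (simp add: transpose_mult[of _ n n _ n])
  also have "\<dots> = A ^\<^sub>m k * A"
    using A by (induction k) (auto simp flip: assoc_mult_mat[of _ n n _ n _ n])
  finally show ?case by simp
qed (use A in auto)

text \<open>By symmetry the power of exponent \<open>2 * k\<close> is \<open>A ^\<^sub>m k\<close>
  times its own transpose.\<close>

lemma diag_pow_mat_double:
  fixes A :: "'a :: comm_semiring_1 mat"
  assumes A: "A \<in> carrier_mat n n" and sym: "transpose_mat A = A" and i: "i < n"
  shows "(A ^\<^sub>m (2 * k)) $$ (i, i) = (\<Sum>j<n. ((A ^\<^sub>m k) $$ (i, j))\<^sup>2)"
proof -
  have "A ^\<^sub>m (k + l) = A ^\<^sub>m k * A ^\<^sub>m l" for l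
    using A by (induction l) (auto simp: assoc_mult_mat[of _ n n _ n _ n])
  then have "A ^\<^sub>m (2 * k) = A ^\<^sub>m k * transpose_mat (A ^\<^sub>m k)"
    using symmetric_pow_mat[OF A sym] by (simp add: mult_2)
  then show ?thesis
    using A i by (simp add: scalar_prod_def atLeast0LessThan power2_eq_square)
qed

lemma diag_pow_mat_lower_bound:
  fixes A :: "real mat"
  assumes A: "A \<in> carrier_mat n n" and sym: "transpose_mat A = A" and i: "i < n"
  shows "(\<Sum>j<n. (A $$ (i, j))\<^sup>2) ^ 2 ^ k \<le> (A ^\<^sub>m 2 ^ Suc k) $$ (i, i)"
proof (induction k)
  case 0
  show ?case using diag_pow_mat_double[OF A sym i, of 1] A by simp
next
  case (Suc k)
  let ?r = "\<Sum>j<n. (A $$ (i, j))\<^sup>2"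
  have "?r ^ 2 ^ Suc k = (?r ^ 2 ^ k)\<^sup>2"
    by (simp add: power_mult[symmetric] mult.commute)
  also have "\<dots> \<le> ((A ^\<^sub>m 2 ^ Suc k) $$ (i, i))\<^sup>2"
    using Suc by (intro power_mono zero_le_power sum_nonneg zero_le_power2)
  \<comment> \<open>Of the squared row norm only the diagonal term is kept on the left, so each
    doubling of the exponent squares the bound.\<close>
  also have "\<dots> \<le> (\<Sum>j<n. ((A ^\<^sub>m 2 ^ Suc k) $$ (i, j))\<^sup>2)"
    using i by (intro member_le_sum) auto
  also have "\<dots> = (A ^\<^sub>m 2 ^ Suc (Suc k)) $$ (i, i)"
    using diag_pow_mat_double[OF A sym i, of "2 ^ Suc k"] by simp
  finally show ?case .
qed

lemma large_eigenvalue_real_symmetric: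
  fixes A :: "real mat"
  assumes A: "A \<in> carrier_mat n n" and sym: "transpose_mat A = A" and i: "i < n"
  shows "\<exists>e. eigenvalue (map_mat complex_of_real A) e \<and> (\<Sum>j<n. (A $$ (i, j))\<^sup>2) \<le> (cmod e)\<^sup>2"
proof (rule ccontr)
  let ?r = "\<Sum>j<n. (A $$ (i, j))\<^sup>2"
  let ?A = "map_mat complex_of_real A"
  let ?\<rho> = "spectral_radius ?A"
  assume no: "\<not> ?thesis"
  have Ac: "?A \<in> carrier_mat n n" using A by simp
  \<comment> \<open>The index \<open>i\<close> shows that the dimension is positive, so the spectral
    radius is attained.\<close>
  have "?\<rho> \<in> norm ` spectrum ?A"
    using spectral_radius_mem_max(1)[OF Ac] i by auto
  then have \<rho>: "0 \<le> ?\<rho>" "?\<rho>\<^sup>2 < ?r"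
    using no by (auto simp: spectrum_def not_le)
  \<comment> \<open>Dividing by an \<open>s\<close> strictly between the spectral radius and the row
    norm brings the radius below 1 while row \<open>i\<close> keeps a norm above 1.\<close>
  then obtain s where s: "?\<rho> < s" "s < sqrt ?r"
    using dense[of ?\<rho> "sqrt ?r"] real_less_rsqrt by blast
  then have "s > 0" using \<rho> by simp
  define B where "B = (1 / s) \<cdot>\<^sub>m A"
  let ?B = "map_mat complex_of_real B"
  have B: "B \<in> carrier_mat n n" using A by (simp add: B_def)
  have "transpose_mat B = (1 / s) \<cdot>\<^sub>m transpose_mat A"
    by (auto simp: B_def)
  then have symB: "transpose_mat B = B" by (simp add: sym B_def)
  have Bc: "?B \<in> carrier_mat n n" using B by simp
  have "spectral_radius ?B < 1"
  proof -
    \<comment> \<open>If \<open>e\<close> is an eigenvalue of \<open>?B\<close>, then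
      \<open>s * e\<close> is one of \<open>?A\<close>, so its modulus is at most
      \<open>?\<rho>\<close>, which is less than \<open>s\<close>.\<close>
    obtain e where e: "eigenvalue ?B e" "spectral_radius ?B = cmod e"
      using spectral_radius_mem_max(1)[OF Bc] i by (auto simp: spectrum_def)
    obtain v where v: "v \<in> carrier_vec n" "v \<noteq> 0\<^sub>v n" "?B *\<^sub>v v = e \<cdot>\<^sub>v v"
      using e Bc unfolding eigenvalue_def eigenvector_def by auto
    have "?A = complex_of_real s \<cdot>\<^sub>m ?B"
      using A \<open>s > 0\<close> by (auto simp: B_def )
    moreover have "(complex_of_real s \<cdot>\<^sub>m ?B) *\<^sub>v v = complex_of_real s \<cdot>\<^sub>v (?B *\<^sub>v v)"
      using v(1) Bc by (intro eq_vecI) (auto simp: scalar_prod_def sum_distrib_left mult.assoc)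
    ultimately have "?A *\<^sub>v v = (s * e) \<cdot>\<^sub>v v"
      using v Bc by (simp add: smult_smult_assoc)
    then have "eigenvalue ?A (s * e)"
      using v A unfolding eigenvalue_def eigenvector_def by auto
    then have "cmod (s * e) \<le> ?\<rho>"
      using i by (intro spectral_radius_mem_max(2)[OF Ac]) (auto simp: spectrum_def)
    then have "s * cmod e \<le> ?\<rho>"
      using \<open>s > 0\<close> by (simp add: norm_mult)
    then have "s * cmod e < s * 1" using s by linarith
    then show ?thesis using e \<open>s > 0\<close> by simp
  qed
  then obtain c where c: "\<And>k. norm_bound (?B ^\<^sub>m k) c"
    using spectral_radius_jnf_norm_bound_less_1_upper_triangular[OF Bc] by blast
  let ?q = "\<Sum>j<n. (B $$ (i, j))\<^sup>2"
  have "s\<^sup>2 < ?r"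
    using s \<open>s > 0\<close> by (metis less_eq_real_def real_sqrt_less_iff real_sqrt_unique)
  moreover have "?q = ?r / s\<^sup>2"
    using A i by (simp add: B_def power_divide sum_divide_distrib)
  ultimately have "1 < ?q" using \<open>s > 0\<close> by simp
  \<comment> \<open>The lower bound covers only exponents \<open>2 ^ m\<close> of \<open>?q\<close>;
    since m \<le> \<open>2 ^ m\<close>, exceeding \<open>c\<close> at exponent \<open>m\<close> is
    enough.\<close>
  then obtain m where "c < ?q ^ m"
    using real_arch_pow by blast
  also have "\<dots> \<le> ?q ^ 2 ^ m"
    using \<open>1 < ?q\<close> by (intro power_increasing) auto
  also have "\<dots> \<le> (B ^\<^sub>m 2 ^ Suc m) $$ (i, i)"
    by (rule diag_pow_mat_lower_bound[OF B symB i])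
  also have "\<dots> \<le> cmod ((?B ^\<^sub>m 2 ^ Suc m) $$ (i, i))"
    using B i by (subst of_real_hom.mat_hom_pow[OF B, symmetric]) simp
  also have "\<dots> \<le> c"
    using c[of "2 ^ Suc m"] Bc i by (auto simp: norm_bound_def)
  finally show False by simp
qed

section \<open>From the eigenvalues of \<open>- L\<close> to those of the state matrix\<close>

lemma eigenvalue_list_iff:
  assumes A: "A \<in> carrier_mat n n" and es: "eigenvalue_list A es"
  shows "eigenvalue (map_mat complex_of_real A) e \<longleftrightarrow> e \<in> set es"
proof -
  have "map_mat complex_of_real A \<in> carrier_mat n n" using A by simp
  then have "eigenvalue (map_mat complex_of_real A) e \<longleftrightarrow> poly (\<Prod>e\<leftarrow>es. [:- e, 1:]) e = 0"
    using es by (simp add: eigenvalue_root_char_poly eigenvalue_list_def)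
  also have "\<dots> \<longleftrightarrow> e \<in> set es" by (induction es) auto
  finally show ?thesis .
qed

text \<open>Vieta: the two roots have sum \<open>- D\<close> and product \<open>- m\<close>. Only
  the square of \<open>csqrt\<close> enters, so its branch is immaterial.\<close>

lemma lambda_plus_minus_factor:
  "[:- lambda_plus D m, 1:] * [:- lambda_minus D m, 1:] = [:- m, of_real D, 1:]"
proof -
  let ?r = "csqrt ((of_real D)\<^sup>2 + 4 * m)"
  have "?r * ?r = of_real D * of_real D + 4 * m"
    using power2_csqrt[of "(of_real D)\<^sup>2 + 4 * m"] by (simp only: power2_eq_square)
  then have "lambda_plus D m * lambda_minus D m = - m"
    by (simp add: lambda_plus_def lambda_minus_def field_simps)
  moreover have "of_real D = - lambda_plus D m - lambda_minus D m"
    by (simp add: lambda_plus_def lambda_minus_def field_simps)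
  moreover have "[:- a, 1:] * [:- b, 1:] = [:a * b, - a - b, 1:]" for a b :: complex
    by simp
  ultimately show ?thesis by metis
qed

text \<open>An identity of polynomials, not of root sets, so algebraic multiplicities carry
  over.\<close>

lemma eigenvalue_list_state_matrix:
  assumes "eigenvalue_list (- laplacian n G) ms"
  shows "eigenvalue_list (state_matrix D n G) (map (lambda_plus D) ms @ map (lambda_minus D) ms)"
proof -
  let ?c = "complex_of_real"
  let ?K = "map_mat ?c (- laplacian n G)"
  have "map_mat ?c (state_matrix D n G) =
      four_block_mat ((- ?c D) \<cdot>\<^sub>m 1\<^sub>m n) (1\<^sub>m n) ?K (0\<^sub>m n n)"
    by (intro eq_matI) (auto simp: state_matrix_def laplacian_def)
  moreover have "?K \<in> carrier_mat n n"
    by (simp add: laplacian_def)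
  ultimately have "char_poly (map_mat ?c (state_matrix D n G)) =
      (\<Prod>m\<leftarrow>ms. [:- m, 1:]) \<circ>\<^sub>p [:0, ?c D, 1:]"
    using assms char_poly_companion_block[of ?K n "- ?c D"] by (simp add: eigenvalue_list_def)
  also have "\<dots> = (\<Prod>m\<leftarrow>ms. [:- m, ?c D, 1:])"
    by (induction ms) (simp_all only: list.map prod_list.Nil prod_list.Cons pcompose_mult, simp_all add: pcompose_pCons)
  also have "\<dots> = (\<Prod>m\<leftarrow>ms. [:- lambda_plus D m, 1:]) * (\<Prod>m\<leftarrow>ms. [:- lambda_minus D m, 1:])"
    by (induction ms) (simp_all only: list.map prod_list.Nil prod_list.Cons
        lambda_plus_minus_factor[symmetric] mult_1 mult_ac)
  finally show ?thesis by (simp add: eigenvalue_list_def comp_def)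
qed

section \<open>Real and non-real roots according to the discriminant\<close>

lemma csqrt_discriminant:
  assumes "0 \<le> D\<^sup>2 + 4 * x"
  shows "csqrt ((complex_of_real D)\<^sup>2 + 4 * complex_of_real x) = complex_of_real (sqrt (D\<^sup>2 + 4 * x))"
  using csqrt_of_real_nonneg[of "complex_of_real (D\<^sup>2 + 4 * x)"] assms by simp

text \<open>The root of the discriminant is below \<open>D\<close> unless \<open>x = 0\<close>,
  where it equals \<open>D\<close> and \<open>lambda_plus\<close> vanishes.\<close>

lemma lambda_real:
  assumes "D > 0" "x \<le> 0" "0 \<le> D\<^sup>2 + 4 * x"
  shows "lambda_plus D (complex_of_real x) \<in> \<real>" "lambda_minus D (complex_of_real x) \<in> \<real>"
    and "Re (lambda_minus D (complex_of_real x)) < 0"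
    and "if x = 0 then lambda_plus D (complex_of_real x) = 0
         else Re (lambda_plus D (complex_of_real x)) < 0"
proof -
  let ?r = "sqrt (D\<^sup>2 + 4 * x)"
  have p: "lambda_plus D (complex_of_real x) = complex_of_real ((- D + ?r) / 2)"
    and m: "lambda_minus D (complex_of_real x) = complex_of_real ((- D - ?r) / 2)"
    unfolding lambda_plus_def lambda_minus_def csqrt_discriminant[OF assms(3)] by simp_all
  have "?r \<ge> 0" using assms by simp
  then have "0 < D + ?r" using assms by linarith
  moreover have "?r < D" if "x \<noteq> 0"
    using assms that by (intro real_less_lsqrt) auto
  ultimately show "lambda_plus D (complex_of_real x) \<in> \<real>" "lambda_minus D (complex_of_real x) \<in> \<real>"
    "Re (lambda_minus D (complex_of_real x)) < 0"
    "if x = 0 then lambda_plus D (complex_of_real x) = 0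
     else Re (lambda_plus D (complex_of_real x)) < 0"
    using assms unfolding p m by (auto simp flip: of_real_add of_real_diff)
qed

lemma lambda_plus_nonreal:
  assumes "D\<^sup>2 + 4 * x < 0"
  shows "lambda_plus D (complex_of_real x) \<notin> \<real>"
proof
  assume "lambda_plus D (complex_of_real x) \<in> \<real>"
  then have "2 * lambda_plus D (complex_of_real x) + complex_of_real D \<in> \<real>" by simp
  also have "2 * lambda_plus D (complex_of_real x) + complex_of_real D =
      csqrt ((complex_of_real D)\<^sup>2 + 4 * complex_of_real x)"
    by (simp add: lambda_plus_def field_simps)
  finally have "csqrt ((complex_of_real D)\<^sup>2 + 4 * complex_of_real x) \<in> \<real>" .
  then obtain y where "csqrt ((complex_of_real D)\<^sup>2 + 4 * complex_of_real x) = complex_of_real y"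
    by (auto elim: Reals_cases)
  then have "complex_of_real (D\<^sup>2 + 4 * x) = complex_of_real (y\<^sup>2)"
    using power2_csqrt[of "(complex_of_real D)\<^sup>2 + 4 * complex_of_real x"] by simp
  then have "D\<^sup>2 + 4 * x = y\<^sup>2" by (simp only: of_real_eq_iff)
  then show False using assms zero_le_power2[of y] by linarith
qed

section \<open>Spectrum of the graph Laplacian\<close>

context
  fixes G :: "nat pair_pre_digraph" and n :: nat
  assumes G: "pair_graph G" and verts: "pverts G = {..<n}"
begin

interpretation pair_graph G by (rule G)

lemma node_degree_eq_card_neighbours: "node_degree G i = card {j. j < n \<and> (i, j) \<in> parcs G}"
proof -
  have "out_arcs (with_proj G) i = Pair i ` {j. j < n \<and> (i, j) \<in> parcs G}"
    using verts in_arcsD2 by (auto simp: out_arcs_def)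
  then show ?thesis by (simp add: out_degree_def card_image inj_on_def)
qed

lemma neg_laplacian_carrier: "- laplacian n G \<in> carrier_mat n n"
  by (simp add: laplacian_def)

lemma neg_laplacian_diag: "i < n \<Longrightarrow> (- laplacian n G) $$ (i, i) = - real (node_degree G i)"
  by (simp add: laplacian_def)

text \<open>Off the diagonal the entries of \<open>- L\<close> are 0 or 1. Two choices of
  \<open>f\<close> are needed: the absolute value for Gershgorin radii and the square for row
  norms.\<close>

lemma sum_off_diagonal_laplacian:
  assumes "i < n" "f 0 = 0" "f 1 = (1 :: real)"
  shows "(\<Sum>j\<in>{..<n} - {i}. f ((- laplacian n G) $$ (i, j))) = real (node_degree G i)"
proof -
  have "(\<Sum>j\<in>{..<n} - {i}. f ((- laplacian n G) $$ (i, j))) =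
      (\<Sum>j\<in>{..<n} - {i}. if (i, j) \<in> parcs G then 1 else 0)"
    using assms by (intro sum.cong) (auto simp: laplacian_def)
  also have "\<dots> = real (card {j \<in> {..<n} - {i}. (i, j) \<in> parcs G})"
    by (simp add: sum.If_cases Int_def)
  \<comment> \<open>Without loops, leaving out \<open>i\<close> loses no neighbour.\<close>
  also have "{j \<in> {..<n} - {i}. (i, j) \<in> parcs G} = {j. j < n \<and> (i, j) \<in> parcs G}"
    using pair_no_loops by fastforce
  finally show ?thesis by (simp add: node_degree_eq_card_neighbours)
qed

lemma transpose_neg_laplacian: "transpose_mat (- laplacian n G) = - laplacian n G"
proof -
  have "(i, j) \<in> parcs G \<longleftrightarrow> (j, i) \<in> parcs G" for i j
    using pair_sym_arcs by (auto simp: symmetric_def elim: symE)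
  then show ?thesis by (auto simp: laplacian_def)
qed

lemma node_degree_le_max_degree: "i < n \<Longrightarrow> node_degree G i \<le> max_degree G"
  using verts by (simp add: max_degree_def)

text \<open>The Gershgorin disc of row \<open>i\<close> has centre \<open>- d\<close> and radius
  \<open>d\<close> for the degree \<open>d\<close> of \<open>i\<close>, so it meets the real axis in
  \<open>[- 2 * d, 0]\<close>.\<close>

lemma neg_laplacian_eigenvalue:
  assumes "eigenvalue (map_mat complex_of_real (- laplacian n G)) e"
  obtains x where "e = complex_of_real x" "- 2 * real (max_degree G) \<le> x" "x \<le> 0"
proof -
  let ?N = "- laplacian n G"
  obtain x where x: "e = complex_of_real x"
    using eigenvalue_real_symmetric[OF neg_laplacian_carrier transpose_neg_laplacian assms] by (auto elim: Reals_cases)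
  obtain i where i: "i < n" and "cmod (e - map_mat complex_of_real ?N $$ (i, i)) \<le>
      (\<Sum>j\<in>{..<n} - {i}. cmod (map_mat complex_of_real ?N $$ (i, j)))"
    using gershgorin[of "map_mat complex_of_real ?N" n, OF _ assms] neg_laplacian_carrier by auto
  then have "\<bar>x + real (node_degree G i)\<bar> \<le> (\<Sum>j\<in>{..<n} - {i}. \<bar>?N $$ (i, j)\<bar>)"
    using neg_laplacian_carrier neg_laplacian_diag[OF i]
      norm_of_real[of "x + real (node_degree G i)", where 'a = complex]
    unfolding x by simp
  also have "\<dots> = real (node_degree G i)"
    using i by (intro sum_off_diagonal_laplacian) auto
  finally have "x \<le> 0" "- 2 * real (node_degree G i) \<le> x" by linarith+
  then show ?thesis
    using that[OF x] node_degree_le_max_degree[OF i] by linarith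
qed

lemma neg_laplacian_small_eigenvalue:
  assumes "0 < max_degree G" "0 < n"
  obtains x where "eigenvalue (map_mat complex_of_real (- laplacian n G)) (complex_of_real x)"
    and "x < - real (max_degree G)"
proof -
  let ?N = "- laplacian n G" and ?d = "real (max_degree G)"
  have "max_degree G \<in> node_degree G ` {..<n}"
    unfolding max_degree_def verts using \<open>0 < n\<close> by (intro Max_in) auto
  then obtain i where i: "i < n" "node_degree G i = max_degree G" by auto
  obtain e where e: "eigenvalue (map_mat complex_of_real ?N) e"
    "(\<Sum>j<n. (?N $$ (i, j))\<^sup>2) \<le> (cmod e)\<^sup>2"
    using large_eigenvalue_real_symmetric[OF neg_laplacian_carrier transpose_neg_laplacian i(1)] by auto
  obtain x where x: "e = complex_of_real x" "x \<le> 0"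
    using neg_laplacian_eigenvalue[OF e(1)] by metis
  have "(\<Sum>j<n. (?N $$ (i, j))\<^sup>2) = (?N $$ (i, i))\<^sup>2 + (\<Sum>j\<in>{..<n} - {i}. (?N $$ (i, j))\<^sup>2)"
    using i by (simp add: sum.remove)
  also have "\<dots> = ?d\<^sup>2 + ?d"
    using i sum_off_diagonal_laplacian[of i "\<lambda>y. y\<^sup>2"] neg_laplacian_diag by simp
  \<comment> \<open>The extra summand \<open>?d\<close>, positive by assumption, makes this strict;
    x \<le> 0 then fixes the sign.\<close>
  finally have "?d\<^sup>2 < (- x)\<^sup>2"
    using e(2) assms x by simp
  then have "?d < - x"
    using x by (intro power_less_imp_less_base[of ?d 2 "- x"]) auto
  then show ?thesis using that[of x] e x by simp
qed

end

section \<open>The two damping thresholds\<close>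

text \<open>Constant vectors lie in the kernel of \<open>L\<close>, so some \<open>\<mu> i\<close>
  is 0 and its \<open>lambda_plus\<close> is 0. Strict negativity in (1) therefore has to except
  this root.\<close>

theorem corollary1:
  fixes G :: "nat pair_pre_digraph" and n :: nat and D :: real and \<mu> :: "nat \<Rightarrow> complex"
  assumes "pair_graph G"
    and "pverts G = {..<n}"
    and "n \<ge> 1"
    and "D > 0"
    and "eigenvalue_list (- laplacian n G) (map \<mu> [0..<n])"
  shows "eigenvalue_list (state_matrix D n G)
           (map (\<lambda>i. lambda_plus D (\<mu> i)) [0..<n] @ map (\<lambda>i. lambda_minus D (\<mu> i)) [0..<n])
         \<and> (D \<ge> sqrt (8 * real (max_degree G)) \<longrightarrow>
              (\<forall>i<n. lambda_plus D (\<mu> i) \<in> \<real> \<and> lambda_minus D (\<mu> i) \<in> \<real> \<and>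
                     Re (lambda_minus D (\<mu> i)) < 0 \<and>
                     (if \<mu> i = 0 then lambda_plus D (\<mu> i) = 0 else Re (lambda_plus D (\<mu> i)) < 0)))
         \<and> (D \<le> sqrt (4 * real (max_degree G)) \<longrightarrow>
              (\<exists>i<n. lambda_plus D (\<mu> i) \<notin> \<real> \<or> lambda_minus D (\<mu> i) \<notin> \<real>))"
proof (intro conjI impI allI)
  let ?N = "- laplacian n G" and ?d = "real (max_degree G)"
  note graph = assms(1,2)
  note ev_iff = eigenvalue_list_iff[OF neg_laplacian_carrier[OF graph] assms(5)]
  show "eigenvalue_list (state_matrix D n G)
      (map (\<lambda>i. lambda_plus D (\<mu> i)) [0..<n] @ map (\<lambda>i. lambda_minus D (\<mu> i)) [0..<n])"
    using eigenvalue_list_state_matrix[OF assms(5), of D] by (simp add: comp_def)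
  {
    fix i
    assume D: "D \<ge> sqrt (8 * ?d)" and "i < n"
    then have "eigenvalue (map_mat complex_of_real ?N) (\<mu> i)"
      unfolding ev_iff by simp
    then obtain x where x: "\<mu> i = complex_of_real x" "- 2 * ?d \<le> x" "x \<le> 0"
      by (rule neg_laplacian_eigenvalue[OF graph])
    \<comment> \<open>The 8 is 4 times 2: the discriminant has the term \<open>4 * x\<close>, and
      \<open>x\<close> can be as low as \<open>- 2 * ?d\<close>.\<close>
    have "8 * ?d \<le> D\<^sup>2" using D \<open>D > 0\<close> sqrt_le_D by blast
    then have "0 \<le> D\<^sup>2 + 4 * x" using x by linarith
    note real = lambda_real[OF \<open>D > 0\<close> \<open>x \<le> 0\<close> this]
    show "lambda_plus D (\<mu> i) \<in> \<real>" "lambda_minus D (\<mu> i) \<in> \<real>"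
      "Re (lambda_minus D (\<mu> i)) < 0"
      "if \<mu> i = 0 then lambda_plus D (\<mu> i) = 0 else Re (lambda_plus D (\<mu> i)) < 0"
      unfolding x(1) of_real_eq_0_iff by (rule real)+
  }
  assume D: "D \<le> sqrt (4 * ?d)"
  \<comment> \<open>Positive damping below the threshold forces an edge, as the strict eigenvalue
    bound requires.\<close>
  then have "0 < sqrt (4 * ?d)" using \<open>D > 0\<close> by linarith
  then obtain x where x: "eigenvalue (map_mat complex_of_real ?N) (complex_of_real x)" "x < - ?d"
    using neg_laplacian_small_eigenvalue[OF graph] assms(3) by auto
  \<comment> \<open>As \<open>x < - ?d\<close> is strict, the discriminant is negative even when
    \<open>D\<close> equals the threshold.\<close>
  have "D\<^sup>2 \<le> 4 * ?d"
    using power_mono[OF D, of 2] \<open>D > 0\<close> by simp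
  then have "lambda_plus D (complex_of_real x) \<notin> \<real>"
    using x by (intro lambda_plus_nonreal) linarith
  moreover obtain i where "i < n" "\<mu> i = complex_of_real x"
    using x(1) unfolding ev_iff by auto
  ultimately show "\<exists>i<n. lambda_plus D (\<mu> i) \<notin> \<real> \<or> lambda_minus D (\<mu> i) \<notin> \<real>"
    by metis
qed

end
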